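(* Let $\mathfrak{L}$ be a finite-dimensional left Leibniz algebra over an algebraically closed field $\mathbb{F}$. Then $\mathfrak{L}$ is supersolvable if, and only if, $\mathfrak{L}$ is solvable and every maximal subalgebra of $\mathfrak{L}$ has codimension one.
   Context: A left Leibniz algebra over a field $\mathbb{F}$ is an $\mathbb{F}$-vector space $\mathfrak{L}$ with a bilinear multiplication satisfying $x(yz)=(xy)z+y(xz)$ for all $x,y,z\in\mathfrak{L}$. Ideals are two-sided. $\mathfrak{L}$ is supersolvable if there is a chain $\mathfrak{L}=\mathfrak{L}_k\supset\mathfrak{L}_{k-1}\supset\cdots\supset\mathfrak{L}_1\supset\mathfrak{L}_0=0$ of ideals of $\mathfrak{L}$ with $\dim_{\mathbb{F}}\mathfrak{L}_j/\mathfrak{L}_{j-1}=1$ for $1\le j\le k$. $\mathfrak{L}$ is solvable if its derived series $\mathfrak{L}^{(0)}=\mathfrak{L}$, $\mathfrak{L}^{(i+1)}=\langle xy\mid x,y\in\mathfrak{L}^{(i)}\rangle_{\mathbb{F}}$ reaches $0$. A maximal subalgebra is a proper subalgebra not contained in any strictly larger proper subalgebra. *)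

theory Defs
  imports "HOL-Computational_Algebra.Polynomial"
begin

context vector_space
begin

text \<open>
  For a subspace \<open>U\<close> of \<open>W\<close>, the quotient space \<open>W / U\<close> has dimension \<open>n\<close>: some \<open>n\<close> vectors of \<open>W\<close>
  represent a basis of \<open>W / U\<close>, i.e. their cosets are linearly independent and generate \<open>W / U\<close>.
  Independence modulo \<open>U\<close> makes the cosets of distinct vectors distinct, so \<open>card B\<close> counts them
  correctly. The lemma \<open>quotient_dim_iff\<close> below relates this to \<open>dim\<close>.
\<close>
definition quotient_dim :: "'b set \<Rightarrow> 'b set \<Rightarrow> nat \<Rightarrow> bool" where
  "quotient_dim W U n \<longleftrightarrow>
    (\<exists>B. finite B \<and> card B = n \<and> span (B \<union> U) = W \<and>
      (\<forall>c. (\<Sum>b\<in>B. c b *s b) \<in> U \<longrightarrow> (\<forall>b\<in>B. c b = 0)))"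

end

lemma (in finite_dimensional_vector_space) quotient_dim_iff:
  assumes U: "subspace U" and W: "subspace W" and "U \<subseteq> W"
  shows "quotient_dim W U n \<longleftrightarrow> dim W = dim U + n"
proof -
  obtain C where C: "C \<subseteq> U" "independent C" "U \<subseteq> span C" "card C = dim U"
    by (rule basis_exists)
  have finC: "finite C" using C(2) by (rule finiteI_independent)
  have spanC: "span C = U" using C U by (simp add: span_subspace)
  have spanU: "span U = U" using U by (simp add: span_eq_iff)
  have unionC: "span (X \<union> C) = span (X \<union> U)" for X
    by (simp only: span_Un spanC spanU)
  have *: "dim W = dim U + card B"
    if B: "finite B" "span (B \<union> U) = W" "\<And>c. (\<Sum>b\<in>B. c b *s b) \<in> U \<Longrightarrow> \<forall>b\<in>B. c b = 0" for B
  proof -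
    have disj: "b \<notin> U" if "b \<in> B" for b
    proof
      assume "b \<in> U"
      have "(\<Sum>x\<in>B. (if x = b then 1 else 0) *s x) = (\<Sum>x\<in>B. if x = b then x else 0)"
        by (intro sum.cong) auto
      also have "\<dots> = b" using B(1) that by simp
      finally have "(\<Sum>x\<in>B. (if x = b then 1 else 0) *s x) \<in> U" using \<open>b \<in> U\<close> by simp
      from B(3)[OF this] that show False by auto
    qed
    have dis: "B \<inter> C = {}" using disj C(1) by blast
    have "independent (B \<union> C)"
      unfolding independent_explicit_finite_subsets
    proof (intro allI impI ballI)
      fix T c v assume T: "T \<subseteq> B \<union> C" and fT: "finite T" and s0: "(\<Sum>w\<in>T. c w *s w) = 0" and v: "v \<in> T"
      define d where "d w = (if w \<in> T then c w else 0)" for w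
      have "(\<Sum>w\<in>T. c w *s w) = (\<Sum>w\<in>B \<union> C. d w *s w)"
        by (rule sum.mono_neutral_cong_left) (use T B(1) finC in \<open>auto simp: d_def\<close>)
      also have "\<dots> = (\<Sum>w\<in>B. d w *s w) + (\<Sum>w\<in>C. d w *s w)"
        by (rule sum.union_disjoint[OF B(1) finC dis])
      finally have eq: "(\<Sum>w\<in>B. d w *s w) + (\<Sum>w\<in>C. d w *s w) = 0" using s0 by simp
      have inU: "(\<Sum>w\<in>C. d w *s w) \<in> U"
        using C(1) by (intro subspace_sum[OF U] subspace_scale[OF U]) auto
      have "(\<Sum>w\<in>B. d w *s w) = - (\<Sum>w\<in>C. d w *s w)" using eq by (simp add: eq_neg_iff_add_eq_0)
      hence "(\<Sum>w\<in>B. d w *s w) \<in> U" using subspace_neg[OF U inU] by simp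
      hence dB: "\<forall>b\<in>B. d b = 0" by (rule B(3))
      hence "(\<Sum>w\<in>B. d w *s w) = 0" by simp
      hence "(\<Sum>w\<in>C. d w *s w) = 0" using eq by simp
      hence "\<forall>w\<in>C. d w = 0" using C(2) finC dependent_finite by blast
      with dB v T show "c v = 0" unfolding d_def by (metis UnE subsetD)
    qed
    moreover have "span (B \<union> C) = span W"
      using B(2) unionC[of B] W by (simp add: span_eq_iff[THEN iffD2])
    ultimately have "dim W = card (B \<union> C)" by (intro dim_eq_card)
    thus ?thesis using card_Un_disjoint[OF B(1) finC dis] C(4) by simp
  qed
  have "\<exists>B. finite B \<and> span (B \<union> U) = W \<and> (\<forall>c. (\<Sum>b\<in>B. c b *s b) \<in> U \<longrightarrow> (\<forall>b\<in>B. c b = 0))"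
  proof -
    obtain D where D: "C \<subseteq> D" "D \<subseteq> W" "independent D" "W \<subseteq> span D"
      using maximal_independent_subset_extend[of C W] C \<open>U \<subseteq> W\<close> by blast
    have fin: "finite D" using D(3) by (rule finiteI_independent)
    have "span (D - C \<union> U) = W"
    proof -
      have "span (D - C \<union> U) = span (D - C \<union> C)" by (rule unionC[symmetric])
      also have "\<dots> = span D" using D(1) by (simp add: Un_absorb2)
      also have "\<dots> = W" using D W by (simp add: span_subspace)
      finally show ?thesis .
    qed
    moreover have "\<forall>b\<in>D - C. c b = 0" if "(\<Sum>b\<in>D - C. c b *s b) \<in> U" for c
    proof -
      have "(\<Sum>b\<in>D - C. c b *s b) \<in> range (\<lambda>e. \<Sum>w\<in>C. e w *s w)"
        using that unfolding span_finite[OF finC, symmetric] spanC .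
      then obtain e where e: "(\<Sum>b\<in>D - C. c b *s b) = (\<Sum>w\<in>C. e w *s w)"
        by blast
      define f where "f w = (if w \<in> C then - e w else c w)" for w
      have "(\<Sum>w\<in>D. f w *s w) = (\<Sum>w\<in>D - C. f w *s w) + (\<Sum>w\<in>C. f w *s w)"
        using sum.subset_diff[OF D(1) fin] .
      also have "(\<Sum>w\<in>D - C. f w *s w) = (\<Sum>b\<in>D - C. c b *s b)"
        by (intro sum.cong) (auto simp: f_def)
      also have "(\<Sum>w\<in>C. f w *s w) = - (\<Sum>w\<in>C. e w *s w)"
        unfolding sum_negf[symmetric] by (intro sum.cong) (auto simp: f_def)
      finally have "(\<Sum>w\<in>D. f w *s w) = 0" using e by simp
      hence "\<forall>w\<in>D. f w = 0" using D(3) fin dependent_finite by blast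
      thus ?thesis by (auto simp: f_def)
    qed
    ultimately show ?thesis using fin by blast
  qed
  then obtain B where B: "finite B" "span (B \<union> U) = W"
      "\<And>c. (\<Sum>b\<in>B. c b *s b) \<in> U \<Longrightarrow> \<forall>b\<in>B. c b = 0"
    by blast
  show ?thesis
  proof
    assume "quotient_dim W U n"
    then obtain B' where B': "finite B'" "card B' = n" "span (B' \<union> U) = W"
        "\<forall>c. (\<Sum>b\<in>B'. c b *s b) \<in> U \<longrightarrow> (\<forall>b\<in>B'. c b = 0)"
      unfolding quotient_dim_def by (elim exE conjE)
    show "dim W = dim U + n"
      using *[OF B'(1,3) mp[OF spec[OF B'(4)]]] B'(2) by simp
  next
    assume "dim W = dim U + n"
    hence "card B = n" using *[OF B] by simp
    thus "quotient_dim W U n"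
      unfolding quotient_dim_def using B by (intro exI[of _ B] conjI allI impI) simp_all
  qed
qed

locale left_leibniz_algebra = vector_space scale
  for scale :: "'a::field \<Rightarrow> 'b::ab_group_add \<Rightarrow> 'b" (infixr \<open>*s\<close> 75) +
  fixes mult :: "'b \<Rightarrow> 'b \<Rightarrow> 'b" (infixl \<open>\<cdot>\<close> 70)
  assumes linear_mult_right: "Vector_Spaces.linear scale scale (\<lambda>y. x \<cdot> y)"
    and linear_mult_left: "Vector_Spaces.linear scale scale (\<lambda>x. x \<cdot> y)"
    and leibniz: "x \<cdot> (y \<cdot> z) = (x \<cdot> y) \<cdot> z + y \<cdot> (x \<cdot> z)"
begin

definition subalgebra :: "'b set \<Rightarrow> bool" where
  "subalgebra S \<longleftrightarrow> subspace S \<and> (\<forall>x\<in>S. \<forall>y\<in>S. x \<cdot> y \<in> S)"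

definition ideal :: "'b set \<Rightarrow> bool" where
  "ideal I \<longleftrightarrow> subspace I \<and> (\<forall>x. \<forall>y\<in>I. x \<cdot> y \<in> I \<and> y \<cdot> x \<in> I)"

definition maximal_subalgebra :: "'b set \<Rightarrow> bool" where
  "maximal_subalgebra M \<longleftrightarrow> subalgebra M \<and> M \<noteq> UNIV \<and>
    (\<forall>S. subalgebra S \<and> S \<noteq> UNIV \<longrightarrow> \<not> M \<subset> S)"

definition supersolvable :: bool where
  "supersolvable \<longleftrightarrow>
    (\<exists>(k::nat) L. L 0 = {0} \<and> L k = UNIV \<and> (\<forall>j\<le>k. ideal (L j)) \<and>
      (\<forall>j<k. L j \<subset> L (Suc j) \<and> quotient_dim (L (Suc j)) (L j) 1))"

primrec derived_series :: "nat \<Rightarrow> 'b set" where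
  "derived_series 0 = UNIV"
| "derived_series (Suc i) = span {x \<cdot> y | x y. x \<in> derived_series i \<and> y \<in> derived_series i}"

definition solvable :: bool where
  "solvable \<longleftrightarrow> (\<exists>i. derived_series i = {0})"

end

locale finite_dimensional_left_leibniz_algebra =
  left_leibniz_algebra scale mult + finite_dimensional_vector_space scale Basis
  for scale :: "'a::field \<Rightarrow> 'b::ab_group_add \<Rightarrow> 'b" (infixr \<open>*s\<close> 75)
    and mult :: "'b \<Rightarrow> 'b \<Rightarrow> 'b" (infixl \<open>\<cdot>\<close> 70)
    and Basis :: "'b set"

end

theory Submission
  imports Defs
begin

text \<open>
  For the converse, a chain of ideals is extended downwards from the whole algebra \<open>L\<close>: if \<open>A / I\<close> is a
  chief factor and \<open>L / A\<close> is supersolvable, then \<open>A / I\<close> has dimension one. Let \<open>N\<close> be the set of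
  elements acting nilpotently along a chain from \<open>A\<close> to \<open>L\<close>; it contains all products, since the
  one-dimensional factors carry commuting scalar actions. Climbing the chain, one compares
  \<open>x \<in> N\<close> with its kernel and image on \<open>A / I\<close>, which are stable under \<open>L\<close>: either \<open>x\<close> acts
  as zero on \<open>A / I\<close>, or it acts bijectively. In the second case the Fitting null component of \<open>x\<close>
  modulo \<open>I\<close> is a maximal subalgebra complementing \<open>A / I\<close>, so its codimension one forces
  \<open>dim (A / I) = 1\<close>. If instead all of \<open>N\<close> acts as zero, then \<open>L\<close> acts on \<open>A / I\<close> by commuting
  operators, which over an algebraically closed field are scalars. Quotient algebras are avoided by
  stating everything modulo the ideal \<open>I\<close> of \<open>L\<close>.
\<close>

subsection \<open>Eigenvectors modulo a subspace\<close>

context finite_dimensional_vector_space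
begin

lemma quotient_dim_1_iff:
  assumes "subspace U" "subspace W" "U \<subseteq> W"
  shows "quotient_dim W U 1 \<longleftrightarrow> dim W = Suc (dim U)"
  using quotient_dim_iff[OF assms] by simp

lemma span_insert_eq_of_dim_Suc:
  assumes "subspace U" "subspace W" "U \<subseteq> W" "dim W = Suc (dim U)" "x \<in> W" "x \<notin> U"
  shows "span (insert x U) = W"
proof (rule subspace_dim_equal)
  show "span (insert x U) \<subseteq> W" using assms by (intro span_minimal) auto
  show "dim W \<le> dim (span (insert x U))"
    using assms by (simp add: dim_insert span_eq_iff[THEN iffD2])
qed (use assms in auto)

text \<open>The form in which one-dimensional factors \<open>W / U\<close> enter later: the class of
  any \<open>x\<close> outside \<open>U\<close> generates the factor.\<close>

lemma dim_Suc_decomp: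
  assumes "subspace U" "subspace W" "U \<subseteq> W" "dim W = Suc (dim U)" "x \<in> W" "x \<notin> U" "w \<in> W"
  obtains c where "w - c *s x \<in> U"
proof -
  have "w \<in> span (insert x U)" using span_insert_eq_of_dim_Suc[OF assms(1-6)] assms(7) by simp
  then obtain c where "w - c *s x \<in> span U" by (rule span_breakdown_eq[THEN iffD1, THEN exE])
  thus thesis using that assms(1) by (simp add: span_eq_iff[THEN iffD2])
qed

lemma dim_less_of_psubset:
  assumes "subspace U" "subspace W" "U \<subset> W"
  shows "dim U < dim W"
  using dim_psubset[of U W] assms by (simp add: span_eq_iff[THEN iffD2])

section \<open>Polynomials in an operator, evaluated at a vector\<close>

lemma linear_dependence_of_iterates:
  obtains n where "(T ^^ n) a \<in> span ((\<lambda>i. (T ^^ i) a) ` {..<n})"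
proof (rule ccontr)
  assume *: "\<not> thesis"
  have "dim ((\<lambda>i. (T ^^ i) a) ` {..<n}) = n" for n
  proof (induction n)
    case (Suc n)
    then show ?case using * that by (auto simp: lessThan_Suc dim_insert)
  qed simp
  \<comment> \<open>If every iterate left the span of the earlier ones, this many iterates would
    exceed the dimension of the space.\<close>
  from this[of "Suc dimension"] show False
    using dim_subset_UNIV by (metis Suc_n_not_le_n)
qed

definition poly_apply :: "'a poly \<Rightarrow> ('b \<Rightarrow> 'b) \<Rightarrow> 'b \<Rightarrow> 'b" where
  "poly_apply p T a = (\<Sum>i\<le>degree p. coeff p i *s (T ^^ i) a)"

lemma poly_apply_bound:
  assumes "degree p \<le> n"
  shows "poly_apply p T a = (\<Sum>i\<le>n. coeff p i *s (T ^^ i) a)"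
  unfolding poly_apply_def
  by (rule sum.mono_neutral_left) (use assms in \<open>auto simp: coeff_eq_0\<close>)

lemma poly_apply_0 [simp]: "poly_apply 0 T a = 0"
  by (simp add: poly_apply_def)

lemma poly_apply_const [simp]: "poly_apply [:c:] T a = c *s a"
  by (simp add: poly_apply_def)

lemma poly_apply_add: "poly_apply (p + q) T a = poly_apply p T a + poly_apply q T a"
proof -
  define n where "n = max (degree p) (degree q)"
  have "degree (p + q) \<le> n" "degree p \<le> n" "degree q \<le> n"
    by (auto simp: n_def degree_add_le_max)
  thus ?thesis by (simp add: poly_apply_bound scale_left_distrib sum.distrib)
qed

lemma poly_apply_smult: "poly_apply (smult c p) T a = c *s poly_apply p T a"
  using degree_smult_le[of c p]
  by (simp only: poly_apply_bound poly_apply_bound[OF order_refl]) (simp add: scale_sum_right)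

lemma poly_apply_monom: "poly_apply (monom c n) T a = c *s (T ^^ n) a"
proof -
  have "poly_apply (monom c n) T a = (\<Sum>i\<le>n. (if i = n then c *s (T ^^ i) a else 0))"
    by (subst poly_apply_bound[of _ n]) (auto simp: degree_monom_le if_distrib[of "\<lambda>d. d *s _"] cong: if_cong intro!: sum.cong)
  thus ?thesis by simp
qed

lemma poly_apply_X:
  assumes "Vector_Spaces.linear scale scale T"
  shows "poly_apply (pCons 0 p) T a = T (poly_apply p T a)"
proof -
  interpret T: Vector_Spaces.linear scale scale T by fact
  have "degree (pCons 0 p) \<le> Suc (degree p)" by (rule degree_pCons_le)
  hence "poly_apply (pCons 0 p) T a = (\<Sum>i\<le>Suc (degree p). coeff (pCons 0 p) i *s (T ^^ i) a)"
    by (rule poly_apply_bound)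
  also have "\<dots> = (\<Sum>i\<le>degree p. coeff p i *s T ((T ^^ i) a))"
    by (subst sum.atMost_Suc_shift) simp
  also have "\<dots> = T (poly_apply p T a)"
    by (simp add: poly_apply_def T.sum T.scale)
  finally show ?thesis .
qed

lemma poly_apply_linear_factor:
  assumes "Vector_Spaces.linear scale scale T"
  shows "poly_apply ([:- c, 1:] * q) T a = T (poly_apply q T a) - c *s poly_apply q T a"
proof -
  have "[:- c, 1:] * q = pCons 0 q + smult (- c) q" by simp
  thus ?thesis by (simp only: poly_apply_add poly_apply_smult poly_apply_X[OF assms]) simp
qed

lemma poly_apply_mem:
  assumes "subspace A" "\<And>b. b \<in> A \<Longrightarrow> T b \<in> A" "a \<in> A"
  shows "poly_apply p T a \<in> A"
proof -
  have "(T ^^ i) a \<in> A" for i by (induction i) (use assms in auto)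
  thus ?thesis unfolding poly_apply_def
    by (intro subspace_sum subspace_scale assms)
qed

text \<open>Some iterate \<open>(T ^^ n) a\<close> equals p(T) a with p of degree below
  \<open>n\<close>; then X^n - p annihilates \<open>a\<close> and is nonzero, having leading
  coefficient 1.\<close>

lemma annihilating_polynomial:
  obtains p where "p \<noteq> 0" "poly_apply p T a = 0"
proof -
  obtain n where n: "(T ^^ n) a \<in> span ((\<lambda>i. (T ^^ i) a) ` {..<n})"
    by (rule linear_dependence_of_iterates)
  \<comment> \<open>Bounding the coefficients instead of the degree also covers
    \<open>n = 0\<close>, where only the zero polynomial is allowed.\<close>
  define V where "V = {v. \<exists>p. (\<forall>i\<ge>n. coeff p i = 0) \<and> poly_apply p T a = v}"
  have "span ((\<lambda>i. (T ^^ i) a) ` {..<n}) \<subseteq> V"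
  proof (rule span_minimal)
    show "(\<lambda>i. (T ^^ i) a) ` {..<n} \<subseteq> V"
    proof clarify
      fix i assume "i < n"
      thus "(T ^^ i) a \<in> V" unfolding V_def
        by (intro CollectI exI[of _ "monom 1 i"]) (auto simp: poly_apply_monom)
    qed
    show "subspace V"
    proof (rule subspaceI)
      show "0 \<in> V" unfolding V_def by (intro CollectI exI[of _ 0]) auto
      fix x y c assume x: "x \<in> V"
      then obtain p where p: "\<forall>i\<ge>n. coeff p i = 0" "poly_apply p T a = x" by (auto simp: V_def)
      show "c *s x \<in> V" unfolding V_def
        by (intro CollectI exI[of _ "smult c p"]) (use p in \<open>auto simp: poly_apply_smult\<close>)
      assume "y \<in> V"
      then obtain q where q: "\<forall>i\<ge>n. coeff q i = 0" "poly_apply q T a = y" by (auto simp: V_def)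
      show "x + y \<in> V" unfolding V_def
        by (intro CollectI exI[of _ "p + q"]) (use p q in \<open>auto simp: poly_apply_add\<close>)
    qed
  qed
  then obtain p where p: "\<forall>i\<ge>n. coeff p i = 0" "poly_apply p T a = (T ^^ n) a"
    using n by (auto simp: V_def)
  show thesis
  proof
    have "coeff (monom 1 n + smult (- 1) p) n = 1" using p(1) by simp
    thus "monom 1 n + smult (- 1) p \<noteq> 0" by (metis coeff_0 zero_neq_one)
    show "poly_apply (monom 1 n + smult (- 1) p) T a = 0"
      by (simp only: poly_apply_add poly_apply_smult poly_apply_monom p(2)) simp
  qed
qed

text \<open>Starting from p(T) a in \<open>I\<close>, linear factors X - z are split off p. The
  process cannot reach a nonzero constant, since \<open>a\<close> is not in \<open>I\<close>; so at
  some point q(T) a leaves \<open>I\<close> while (T - z) q(T) a is in \<open>I\<close>, and q(T) a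
  is the eigenvector. Algebraic closedness appears as the hypothesis \<open>root\<close> because the
  locale fixes an arbitrary field.\<close>

lemma eigenvector_modulo_subspace:
  assumes root: "\<And>p::'a poly. degree p > 0 \<Longrightarrow> \<exists>z. poly p z = 0"
    and T: "Vector_Spaces.linear scale scale T"
    and I: "subspace I" and A: "subspace A" "\<And>b. b \<in> A \<Longrightarrow> T b \<in> A"
    and a: "a \<in> A" "a \<notin> I"
  obtains b c where "b \<in> A" "b \<notin> I" "T b - c *s b \<in> I"
proof -
  obtain p where "p \<noteq> 0" "poly_apply p T a = 0" by (rule annihilating_polynomial)
  hence "p \<noteq> 0" "poly_apply p T a \<in> I" using subspace_0[OF I] by auto
  hence "\<exists>b c. b \<in> A \<and> b \<notin> I \<and> T b - c *s b \<in> I"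
  proof (induction "degree p" arbitrary: p rule: less_induct)
    case less
    show ?case
    proof (cases "degree p = 0")
      case True
      then obtain c where c: "p = [:c:]" by (rule degree_eq_zeroE)
      hence "c \<noteq> 0" "c *s a \<in> I" using less.prems by auto
      hence "a \<in> I" using subspace_scale[OF I, of "c *s a" "inverse c"] by simp
      thus ?thesis using a by blast
    next
      case False
      then obtain z where "poly p z = 0" using root by blast
      then obtain q where q: "p = [:- z, 1:] * q" by (auto simp: poly_eq_0_iff_dvd elim: dvdE)
      hence q0: "q \<noteq> 0" using less.prems by auto
      have deg: "degree q < degree p" unfolding q using q0 by (subst degree_mult_eq) auto
      show ?thesis
      proof (cases "poly_apply q T a \<in> I")
        case True
        show ?thesis by (rule less.hyps[OF deg q0 True])
      next
        case False
        have "T (poly_apply q T a) - z *s poly_apply q T a \<in> I"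
          using less.prems(2) unfolding q poly_apply_linear_factor[OF T] .
        moreover have "poly_apply q T a \<in> A" using A a(1) by (rule poly_apply_mem)
        ultimately show ?thesis using False by blast
      qed
    qed
  qed
  thus thesis using that by blast
qed

end

subsection \<open>Ideals and subalgebras of Leibniz algebras\<close>

context finite_dimensional_left_leibniz_algebra
begin

lemma mult_add_right: "x \<cdot> (y + z) = x \<cdot> y + x \<cdot> z"
  and mult_scale_right: "x \<cdot> (c *s y) = c *s (x \<cdot> y)"
  and mult_diff_right: "x \<cdot> (y - z) = x \<cdot> y - x \<cdot> z"
  and mult_zero_right: "x \<cdot> 0 = 0"
proof -
  interpret f: Vector_Spaces.linear scale scale "\<lambda>y. x \<cdot> y" by (rule linear_mult_right)
  show "x \<cdot> (y + z) = x \<cdot> y + x \<cdot> z" "x \<cdot> (c *s y) = c *s (x \<cdot> y)"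
    "x \<cdot> (y - z) = x \<cdot> y - x \<cdot> z" "x \<cdot> 0 = 0"
    by (fact f.add f.scale f.diff f.zero)+
qed

lemma mult_add_left: "(x + y) \<cdot> z = x \<cdot> z + y \<cdot> z"
  and mult_scale_left: "(c *s x) \<cdot> z = c *s (x \<cdot> z)"
  and mult_diff_left: "(x - y) \<cdot> z = x \<cdot> z - y \<cdot> z"
  and mult_zero_left: "0 \<cdot> z = 0"
proof -
  interpret f: Vector_Spaces.linear scale scale "\<lambda>x. x \<cdot> z" by (rule linear_mult_left)
  show "(x + y) \<cdot> z = x \<cdot> z + y \<cdot> z" "(c *s x) \<cdot> z = c *s (x \<cdot> z)"
    "(x - y) \<cdot> z = x \<cdot> z - y \<cdot> z" "0 \<cdot> z = 0"
    by (fact f.add f.scale f.diff f.zero)+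
qed

lemmas mult_linear_simps =
  mult_add_right mult_scale_right mult_diff_right mult_zero_right
  mult_add_left mult_scale_left mult_diff_left mult_zero_left

text \<open>Left multiplication by a product is the commutator of the left multiplications. The next
  two lemmas follow because commutators are alternating.\<close>

lemma mult_mult_left: "(x \<cdot> y) \<cdot> z = x \<cdot> (y \<cdot> z) - y \<cdot> (x \<cdot> z)"
  by (simp add: leibniz[of x y z])

lemma square_mult_eq_0: "(x \<cdot> x) \<cdot> y = 0"
  by (simp add: mult_mult_left)

lemma anticommutator_mult_eq_0: "(x \<cdot> y + y \<cdot> x) \<cdot> z = 0"
  by (simp add: mult_mult_left mult_add_left)

lemma subspace_preimage_right: "subspace V \<Longrightarrow> subspace {w. x \<cdot> w \<in> V}"
  by (rule subspaceI) (auto simp: mult_linear_simps subspace_0 subspace_add subspace_scale)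

lemma subspace_preimage_left: "subspace V \<Longrightarrow> subspace {w. w \<cdot> x \<in> V}"
  by (rule subspaceI) (auto simp: mult_linear_simps subspace_0 subspace_add subspace_scale)

lemma span_mult_closed_right:
  assumes "\<And>g. g \<in> G \<Longrightarrow> x \<cdot> g \<in> V" "subspace V" "w \<in> span G"
  shows "x \<cdot> w \<in> V"
  using span_minimal[of G "{w. x \<cdot> w \<in> V}"] subspace_preimage_right[of V x] assms by auto

lemma span_mult_closed_left:
  assumes "\<And>g. g \<in> G \<Longrightarrow> g \<cdot> x \<in> V" "subspace V" "w \<in> span G"
  shows "w \<cdot> x \<in> V"
  using span_minimal[of G "{w. w \<cdot> x \<in> V}"] subspace_preimage_left[of V x] assms by auto

lemma ideal_spanI:
  assumes "\<And>x g. g \<in> G \<Longrightarrow> x \<cdot> g \<in> span G" "\<And>x g. g \<in> G \<Longrightarrow> g \<cdot> x \<in> span G"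
  shows "ideal (span G)"
  unfolding ideal_def
proof (intro conjI allI ballI subspace_span)
  fix x w assume w: "w \<in> span G"
  show "x \<cdot> w \<in> span G" by (rule span_mult_closed_right[OF assms(1) subspace_span w])
  show "w \<cdot> x \<in> span G" by (rule span_mult_closed_left[OF assms(2) subspace_span w])
qed

lemma ideal_subspace: "ideal I \<Longrightarrow> subspace I"
  and ideal_right: "ideal I \<Longrightarrow> y \<in> I \<Longrightarrow> x \<cdot> y \<in> I"
  and ideal_left: "ideal I \<Longrightarrow> x \<in> I \<Longrightarrow> x \<cdot> y \<in> I"
  by (auto simp: ideal_def)

lemma subalgebra_subspace: "subalgebra S \<Longrightarrow> subspace S"
  and subalgebra_mult: "subalgebra S \<Longrightarrow> x \<in> S \<Longrightarrow> y \<in> S \<Longrightarrow> x \<cdot> y \<in> S"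
  by (auto simp: subalgebra_def)

lemma mem_span_Un_iff:
  assumes "subspace S" "subspace J"
  shows "x \<in> span (S \<union> J) \<longleftrightarrow> (\<exists>s\<in>S. \<exists>u\<in>J. x = s + u)"
proof -
  have "span S = S" "span J = J" using assms by (simp_all only: span_eq_iff)
  thus ?thesis unfolding span_Un by blast
qed

lemma subalgebra_sum_ideal:
  assumes S: "subalgebra S" and J: "ideal J"
  shows "subalgebra (span (S \<union> J))"
  unfolding subalgebra_def
proof (intro conjI ballI)
  fix x y assume "x \<in> span (S \<union> J)" "y \<in> span (S \<union> J)"
  then obtain s u t v where *: "s \<in> S" "u \<in> J" "t \<in> S" "v \<in> J" "x = s + u" "y = t + v"
    unfolding mem_span_Un_iff[OF subalgebra_subspace[OF S] ideal_subspace[OF J]] by blast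
  have "x \<cdot> y = s \<cdot> t + (s \<cdot> v + u \<cdot> t + u \<cdot> v)"
    by (simp add: * mult_linear_simps algebra_simps)
  moreover have "s \<cdot> v + u \<cdot> t + u \<cdot> v \<in> J"
    using * J by (intro subspace_add ideal_subspace) (auto intro: ideal_right ideal_left)
  ultimately show "x \<cdot> y \<in> span (S \<union> J)"
    using subalgebra_mult[OF S *(1,3)] by (simp only: span_add span_base UnI1 UnI2)
qed simp

section \<open>Supersolvability of the quotient by an ideal, in terms of ideals above it\<close>

definition supersolvable_above :: "'b set \<Rightarrow> bool" where
  "supersolvable_above I \<longleftrightarrow>
    (\<exists>(k::nat) L. L 0 = I \<and> L k = UNIV \<and> (\<forall>j\<le>k. ideal (L j)) \<and>
      (\<forall>j<k. L j \<subset> L (Suc j) \<and> quotient_dim (L (Suc j)) (L j) 1))"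

lemma supersolvable_iff: "supersolvable \<longleftrightarrow> supersolvable_above {0}"
  by (simp add: supersolvable_def supersolvable_above_def)

text \<open>Replaces quotient dimensions by \<open>dim\<close>; strictness of the inclusions follows
  from the dimension count.\<close>

lemma supersolvable_above_alt:
  "supersolvable_above I \<longleftrightarrow>
    (\<exists>(k::nat) L. L 0 = I \<and> L k = UNIV \<and> (\<forall>j\<le>k. ideal (L j)) \<and>
      (\<forall>j<k. L j \<subseteq> L (Suc j) \<and> dim (L (Suc j)) = Suc (dim (L j))))"
proof -
  have "L j \<subset> L (Suc j) \<and> quotient_dim (L (Suc j)) (L j) 1 \<longleftrightarrow>
      L j \<subseteq> L (Suc j) \<and> dim (L (Suc j)) = Suc (dim (L j))"
    if "\<forall>j\<le>k. ideal (L j)" "j < k" for L j and k :: nat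
  proof -
    have "subspace (L j)" "subspace (L (Suc j))" using that by (auto intro: ideal_subspace)
    from quotient_dim_1_iff[OF this] show ?thesis by (metis n_not_Suc_n psubset_eq)
  qed
  hence "(L 0 = I \<and> L k = UNIV \<and> (\<forall>j\<le>k. ideal (L j)) \<and>
      (\<forall>j<k. L j \<subset> L (Suc j) \<and> quotient_dim (L (Suc j)) (L j) 1)) \<longleftrightarrow>
    (L 0 = I \<and> L k = UNIV \<and> (\<forall>j\<le>k. ideal (L j)) \<and>
      (\<forall>j<k. L j \<subseteq> L (Suc j) \<and> dim (L (Suc j)) = Suc (dim (L j))))" for L and k :: nat
    by meson
  thus ?thesis unfolding supersolvable_above_def by (simp only:)
qed

lemma supersolvable_above_UNIV: "supersolvable_above UNIV"
  unfolding supersolvable_above_def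
  by (intro exI[of _ 0] exI[of _ "\<lambda>_. UNIV"]) (auto simp: ideal_def)

lemma supersolvable_above_step:
  assumes I: "ideal I" and A: "I \<subseteq> A" "dim A = Suc (dim I)" "supersolvable_above A"
  shows "supersolvable_above I"
proof -
  obtain k L where L: "L 0 = A" "L k = UNIV" "\<forall>j\<le>k. ideal (L j)"
    "\<forall>j<k. L j \<subseteq> L (Suc j) \<and> dim (L (Suc j)) = Suc (dim (L j))"
    using A(3) unfolding supersolvable_above_alt by blast
  show ?thesis unfolding supersolvable_above_alt
    \<comment> \<open>\<open>case_nat I L\<close> puts \<open>I\<close> in front of the chain and
      shifts the other members by one.\<close>
    by (intro exI[of _ "Suc k"] exI[of _ "case_nat I L"])
      (use L I A in \<open>auto split: nat.split\<close>)
qed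

section \<open>Consequences of supersolvability\<close>

lemma solvable_of_supersolvable:
  assumes "supersolvable"
  shows "solvable"
proof -
  obtain k L where L: "L 0 = {0}" "L k = UNIV" "\<forall>j\<le>k. ideal (L j)"
    "\<forall>j<k. L j \<subseteq> L (Suc j) \<and> dim (L (Suc j)) = Suc (dim (L j))"
    using assms unfolding supersolvable_iff supersolvable_above_alt by blast
  have prod: "x \<cdot> y \<in> L j" if j: "j < k" and x: "x \<in> L (Suc j)" and y: "y \<in> L (Suc j)" for j x y
  proof -
    have id: "ideal (L j)" "ideal (L (Suc j))" and sub: "subspace (L j)" "subspace (L (Suc j))"
      using L(3) j by (auto intro: ideal_subspace)
    have sb: "L j \<subseteq> L (Suc j)" "dim (L (Suc j)) = Suc (dim (L j))" using L j by auto
    note decomp = dim_Suc_decomp[OF sub sb]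
    show ?thesis
    proof (cases "x \<in> L j")
      case True thus ?thesis using id ideal_left by blast
    next
      case False
      \<comment> \<open>Otherwise \<open>x \<cdot> x\<close> generates the factor, so
        \<open>x\<close> is a multiple of it modulo \<open>L j\<close>. Multiplying by
        \<open>x\<close> on the right kills that multiple, as squares annihilate from the left, and
        leaves \<open>x \<cdot> x\<close> in \<open>L j\<close>.\<close>
      have xx: "x \<cdot> x \<in> L j"
      proof (rule ccontr)
        assume n: "x \<cdot> x \<notin> L j"
        have "x \<cdot> x \<in> L (Suc j)" using id x ideal_left by blast
        then obtain c where "x - c *s (x \<cdot> x) \<in> L j" using decomp n x by blast
        hence "(x - c *s (x \<cdot> x)) \<cdot> x \<in> L j" by (rule ideal_left[OF id(1)])
        thus False using n by (simp add: mult_linear_simps square_mult_eq_0)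
      qed
      obtain c where "y - c *s x \<in> L j" using decomp False x y by blast
      hence "x \<cdot> (y - c *s x) + c *s (x \<cdot> x) \<in> L j"
        by (rule subspace_add[OF sub(1) ideal_right[OF id(1)] subspace_scale[OF sub(1) xx]])
      thus ?thesis by (simp add: mult_linear_simps)
    qed
  qed
  \<comment> \<open>By \<open>prod\<close>, each derivation step descends at least one member of the
    chain.\<close>
  have "i \<le> k \<Longrightarrow> derived_series i \<subseteq> L (k - i)" for i
  proof (induction i)
    case (Suc i)
    hence eq: "k - i = Suc (k - Suc i)" by simp
    show ?case unfolding derived_series.simps
    proof (rule span_minimal)
      show "subspace (L (k - Suc i))" using L(3) by (simp add: ideal_subspace)
      show "{x \<cdot> y |x y. x \<in> derived_series i \<and> y \<in> derived_series i} \<subseteq> L (k - Suc i)"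
        using prod[of "k - Suc i"] Suc eq by auto
    qed
  qed (use L in auto)
  from this[of k] have "derived_series k \<subseteq> {0}" using L by simp
  moreover have "0 \<in> derived_series k" by (cases k) (auto simp: span_zero)
  ultimately show ?thesis unfolding solvable_def by blast
qed

text \<open>Take the first member \<open>L m\<close> of the chain not inside \<open>M\<close>. By
  maximality \<open>M\<close> and \<open>L m\<close> together span everything, while
  \<open>L m\<close> exceeds its predecessor, which lies in \<open>M\<close>, by one dimension
  only.\<close>

lemma maximal_subalgebra_codim_1_of_supersolvable:
  assumes "supersolvable" and M: "maximal_subalgebra M"
  shows "quotient_dim UNIV M 1"
proof -
  obtain k L where L: "L 0 = {0}" "L k = UNIV" "\<forall>j\<le>k. ideal (L j)"
    "\<forall>j<k. L j \<subseteq> L (Suc j) \<and> dim (L (Suc j)) = Suc (dim (L j))"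
    using assms unfolding supersolvable_iff supersolvable_above_alt by blast
  have subM: "subalgebra M" and sM: "subspace M" and MU: "M \<noteq> UNIV"
    using M by (auto simp: maximal_subalgebra_def subalgebra_def)
  define m where "m = (LEAST j. \<not> L j \<subseteq> M)"
  have kM: "\<not> L k \<subseteq> M" using L MU by auto
  have m: "\<not> L m \<subseteq> M" unfolding m_def by (rule LeastI) (rule kM)
  have mk: "m \<le> k" unfolding m_def by (rule Least_le) (rule kM)
  have "m \<noteq> 0" using m L(1) subspace_0[OF sM] by auto
  then obtain j where j: "m = Suc j" by (cases m) auto
  have jM: "L j \<subseteq> M" using not_less_Least[of j "\<lambda>j. \<not> L j \<subseteq> M"] j by (auto simp: m_def)
  have id: "ideal (L j)" "ideal (L m)" and sub: "subspace (L j)" "subspace (L m)"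
    using L(3) j mk by (auto intro: ideal_subspace)
  have sb: "L j \<subseteq> L m" "dim (L m) = Suc (dim (L j))" using L(4) j mk by auto
  obtain e where e: "e \<in> L m" "e \<notin> M" using m by blast
  have "subalgebra (span (M \<union> L m))" by (rule subalgebra_sum_ideal) fact+
  moreover have "M \<subset> span (M \<union> L m)" using e by (auto intro: span_base)
  ultimately have "span (M \<union> L m) = UNIV" using M unfolding maximal_subalgebra_def by blast
  moreover have "span (M \<union> L m) \<subseteq> span (insert e M)"
  proof (rule span_minimal)
    have "L m = span (insert e (L j))"
      using span_insert_eq_of_dim_Suc[OF sub sb e(1)] e(2) jM by auto
    thus "M \<union> L m \<subseteq> span (insert e M)"
      using span_mono[of "insert e (L j)" "insert e M"] jM by (auto intro: span_base)
  qed simp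
  ultimately have "span (insert e M) = UNIV" by blast
  hence "dim (UNIV :: 'b set) = dim (insert e M)" by (metis dim_span)
  also have "\<dots> = Suc (dim M)" using e(2) sM by (simp add: dim_insert span_eq_iff[THEN iffD2])
  finally show ?thesis using sM by (subst quotient_dim_1_iff) auto
qed

section \<open>The Fitting null component of a left multiplication modulo an ideal\<close>

definition fitting_null :: "'b set \<Rightarrow> 'b \<Rightarrow> 'b set" where
  "fitting_null I x = {y. \<exists>n. (mult x ^^ n) y \<in> I}"

lemma fitting_null_base: "y \<in> I \<Longrightarrow> y \<in> fitting_null I x"
  unfolding fitting_null_def by (intro CollectI exI[of _ 0]) simp

lemma fitting_null_step: "x \<cdot> y \<in> fitting_null I x \<Longrightarrow> y \<in> fitting_null I x"
  unfolding fitting_null_def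
proof clarify
  fix n assume "(mult x ^^ n) (x \<cdot> y) \<in> I"
  thus "\<exists>n. (mult x ^^ n) y \<in> I" by (intro exI[of _ "Suc n"]) (simp add: funpow_swap1)
qed

text \<open>Left multiplication by \<open>x\<close> is a derivation. Closure under products is an
  induction on the sum of the two exponents: both terms of \<open>x \<cdot> (y \<cdot> z)\<close>
  have a smaller sum, and an exponent 0 puts a factor into the ideal \<open>I\<close>.\<close>

lemma subalgebra_fitting_null:
  assumes I: "ideal I"
  shows "subalgebra (fitting_null I x)"
proof -
  have sub: "subspace (fitting_null I x)"
  proof (rule subspaceI)
    show "0 \<in> fitting_null I x" using subspace_0[OF ideal_subspace[OF I]] by (rule fitting_null_base)
  next
    have "subspace {y. (mult x ^^ n) y \<in> I}" for n
    proof (induction n)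
      case (Suc n)
      from subspace_preimage_right[OF this, of x] show ?case
        by (simp add: funpow_swap1)
    qed (use I ideal_subspace in auto)
    note s = this
    have mono: "(mult x ^^ m) y \<in> I" if "(mult x ^^ n) y \<in> I" "n \<le> m" for n m y
      using that(2,1) by (induction rule: dec_induct) (auto intro: ideal_right[OF I])
    fix y z c assume "y \<in> fitting_null I x"
    then obtain n where n: "(mult x ^^ n) y \<in> I" by (auto simp: fitting_null_def)
    show "c *s y \<in> fitting_null I x" using subspace_scale[OF s[of n]] n
      by (auto simp: fitting_null_def)
    assume "z \<in> fitting_null I x"
    then obtain m where m: "(mult x ^^ m) z \<in> I" by (auto simp: fitting_null_def)
    have "(mult x ^^ max n m) (y + z) \<in> I"
      using subspace_add[OF s[of "max n m"]] mono[OF n, of "max n m"] mono[OF m, of "max n m"] by auto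
    thus "y + z \<in> fitting_null I x" by (auto simp: fitting_null_def)
  qed
  have "y \<cdot> z \<in> fitting_null I x" if "(mult x ^^ n) y \<in> I" "(mult x ^^ m) z \<in> I" for n m y z
    using that
  proof (induction "n + m" arbitrary: n m y z rule: less_induct)
    case less
    show ?case
    proof (cases "n = 0 \<or> m = 0")
      case True
      thus ?thesis using less.prems ideal_left[OF I] ideal_right[OF I]
        by (auto intro: fitting_null_base)
    next
      case False
      then obtain n' m' where nm: "n = Suc n'" "m = Suc m'" by (meson not0_implies_Suc)
      have "(mult x ^^ n') (x \<cdot> y) \<in> I" "(mult x ^^ m') (x \<cdot> z) \<in> I"
        using less.prems by (auto simp: nm funpow_swap1)
      hence "(x \<cdot> y) \<cdot> z \<in> fitting_null I x" "y \<cdot> (x \<cdot> z) \<in> fitting_null I x"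
        using less.hyps[of n' m "x \<cdot> y" z] less.hyps[of n m' y "x \<cdot> z"] less.prems nm by auto
      hence "x \<cdot> (y \<cdot> z) \<in> fitting_null I x" unfolding leibniz[of x y z] by (rule subspace_add[OF sub])
      thus ?thesis by (rule fitting_null_step)
    qed
  qed
  thus ?thesis unfolding subalgebra_def using sub by (auto simp: fitting_null_def)
qed

end

subsection \<open>Chief factors\<close>

locale leibniz_chief_factor = finite_dimensional_left_leibniz_algebra +
  fixes I A
  assumes ideal_I: "ideal I" and ideal_A: "ideal A" and I_psubset_A: "I \<subset> A"
    and chief: "\<And>J. ideal J \<Longrightarrow> I \<subseteq> J \<Longrightarrow> J \<subseteq> A \<Longrightarrow> J = I \<or> J = A"
begin

lemmas subspace_I = ideal_subspace[OF ideal_I]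
lemmas subspace_A = ideal_subspace[OF ideal_A]

text \<open>The right action on \<open>A / I\<close> is either zero or the negative of the left action, because the
  anticommutators \<open>a \<cdot> x + x \<cdot> a\<close> span an ideal which annihilates the algebra from the left.\<close>
lemma left_stable_cases:
  assumes W: "subspace W" "I \<subseteq> W" "W \<subseteq> A" "\<And>y w. w \<in> W \<Longrightarrow> y \<cdot> w \<in> W"
  shows "W = I \<or> W = A"
proof -
  define G where "G = I \<union> {a \<cdot> x + x \<cdot> a | a x. a \<in> A}"
  have GI: "a \<cdot> x + x \<cdot> a \<in> span G" if "a \<in> A" for a x
    using that by (intro span_base) (auto simp: G_def)
  have IG: "I \<subseteq> span G" by (auto simp: G_def intro: span_base)
  have "y \<cdot> (a \<cdot> x + x \<cdot> a) \<in> span G" if "a \<in> A" for a x y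
  proof -
    have "y \<cdot> (a \<cdot> x + x \<cdot> a)
        = ((y \<cdot> a) \<cdot> x + x \<cdot> (y \<cdot> a)) + (a \<cdot> (y \<cdot> x) + (y \<cdot> x) \<cdot> a)"
      by (simp add: mult_add_right leibniz[of y])
    also have "\<dots> \<in> span G" using that ideal_right[OF ideal_A] by (intro span_add GI)
    finally show ?thesis .
  qed
  moreover have "(a \<cdot> x + x \<cdot> a) \<cdot> y = 0" for a x y by (rule anticommutator_mult_eq_0)
  ultimately have idG: "ideal (span G)"
    using ideal_left[OF ideal_I] ideal_right[OF ideal_I] IG
    by (intro ideal_spanI) (auto simp: G_def span_zero)
  have "span G \<subseteq> A" using ideal_left[OF ideal_A] ideal_right[OF ideal_A] I_psubset_A
    by (intro span_minimal subspace_A) (auto simp: G_def intro!: subspace_add[OF subspace_A])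
  hence "span G = I \<or> span G = A" using chief[OF idG IG] by blast
  \<comment> \<open>If \<open>span G\<close> is \<open>I\<close>, then \<open>w \<cdot> y\<close> is
    \<open>- (y \<cdot> w)\<close> modulo \<open>W\<close>. If it is \<open>A\<close>, then
    \<open>w\<close> is a combination of elements that multiply everything on their right into
    \<open>I\<close>.\<close>
  hence "w \<cdot> y \<in> W" if "w \<in> W" for w y
  proof
    assume "span G = I"
    hence "w \<cdot> y + y \<cdot> w \<in> W" using GI that W(2,3) by blast
    thus ?thesis using subspace_diff[OF W(1) _ W(4)[OF that, of y]] by force
  next
    assume eq: "span G = A"
    have "w \<cdot> y \<in> I"
    proof (rule span_mult_closed_left[OF _ subspace_I])
      show "w \<in> span G" using that W eq by blast
      fix g assume "g \<in> G"
      thus "g \<cdot> y \<in> I" using ideal_left[OF ideal_I] anticommutator_mult_eq_0 subspace_0[OF subspace_I]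
        by (auto simp: G_def)
    qed
    thus ?thesis using W by blast
  qed
  hence "ideal W" using W by (auto simp: ideal_def)
  thus ?thesis using chief W by blast
qed

text \<open>The products of elements of \<open>A\<close> span, together with \<open>I\<close>, an
  ideal that is \<open>I\<close> or \<open>A\<close>. In the second case \<open>A\<close> lies in
  \<open>derived_series i\<close> plus \<open>I\<close> for every \<open>i\<close>, and solvability
  would force \<open>A\<close> into \<open>I\<close>.\<close>

lemma abelian_of_solvable:
  assumes "solvable" "a \<in> A" "b \<in> A"
  shows "a \<cdot> b \<in> I"
proof -
  define G where "G = I \<union> {a \<cdot> b | a b. a \<in> A \<and> b \<in> A}"
  have G: "a \<cdot> b \<in> span G" if "a \<in> A" "b \<in> A" for a b
    using that by (intro span_base) (auto simp: G_def)
  have IG: "I \<subseteq> span G" by (auto simp: G_def intro: span_base)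
  have "y \<cdot> (a \<cdot> b) \<in> span G" "(a \<cdot> b) \<cdot> y \<in> span G" if "a \<in> A" "b \<in> A" for a b y
    using that ideal_right[OF ideal_A] ideal_left[OF ideal_A]
    by (auto simp: leibniz[of y] mult_mult_left[of a] intro!: span_add span_diff G)
  hence idG: "ideal (span G)"
    using ideal_left[OF ideal_I] ideal_right[OF ideal_I] IG
    by (intro ideal_spanI) (auto simp: G_def)
  have "span G \<subseteq> A" using ideal_left[OF ideal_A] I_psubset_A
    by (intro span_minimal subspace_A) (auto simp: G_def)
  hence "span G = I \<or> span G = A" using chief[OF idG IG] by blast
  thus ?thesis
  proof
    assume "span G = I" thus ?thesis using G assms by blast
  next
    assume eq: "span G = A"
    have sD: "subspace (derived_series i)" for i by (cases i) auto
    have "A \<subseteq> span (derived_series i \<union> I)" for i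
    proof (induction i)
      case (Suc i)
      have "G \<subseteq> span (derived_series (Suc i) \<union> I)"
        unfolding G_def
      proof (intro Un_least)
        show "I \<subseteq> span (derived_series (Suc i) \<union> I)" by (auto intro: span_base)
        show "{a \<cdot> b | a b. a \<in> A \<and> b \<in> A} \<subseteq> span (derived_series (Suc i) \<union> I)"
        proof clarify
          fix a b assume "a \<in> A" "b \<in> A"
          then obtain s u t v where *: "s \<in> derived_series i" "t \<in> derived_series i" "u \<in> I" "v \<in> I"
            "a = s + u" "b = t + v"
            using Suc unfolding subset_iff mem_span_Un_iff[OF sD subspace_I] by blast
          have "a \<cdot> b = s \<cdot> t + (s \<cdot> v + u \<cdot> t + u \<cdot> v)"
            by (simp add: * mult_linear_simps algebra_simps)
          moreover have "s \<cdot> t \<in> derived_series (Suc i)" using * by (auto intro!: span_base)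
          moreover have "s \<cdot> v + u \<cdot> t + u \<cdot> v \<in> I"
            using * ideal_left[OF ideal_I] ideal_right[OF ideal_I]
            by (intro subspace_add subspace_I) auto
          ultimately show "a \<cdot> b \<in> span (derived_series (Suc i) \<union> I)"
            by (simp only: span_add span_base UnI1 UnI2)
        qed
      qed
      thus ?case using eq span_minimal[of G] by auto
    qed simp
    moreover obtain i where "derived_series i = {0}" using assms(1) by (auto simp: solvable_def)
    ultimately have "A \<subseteq> span ({0} \<union> I)" by metis
    hence "A \<subseteq> I" using subspace_I by (simp add: span_eq_iff[THEN iffD2])
    thus ?thesis using I_psubset_A by blast
  qed
qed

text \<open>A subalgebra \<open>M\<close> strictly above the complement \<open>S\<close> meets
  \<open>A\<close> in a left stable subspace, hence in \<open>I\<close> or \<open>A\<close>. The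
  first gives \<open>M = S\<close>, the second \<open>M = UNIV\<close>. So \<open>S\<close> is
  maximal, and its codimension is the dimension of \<open>A / I\<close>.\<close>

lemma dim_1_of_complement:
  assumes abel: "\<And>a b. a \<in> A \<Longrightarrow> b \<in> A \<Longrightarrow> a \<cdot> b \<in> I"
    and codim: "\<And>M. maximal_subalgebra M \<Longrightarrow> quotient_dim UNIV M 1"
    and S: "subalgebra S" "I \<subseteq> S" "S \<inter> A \<subseteq> I" "\<And>y. \<exists>a\<in>A. y - a \<in> S"
  shows "dim A = Suc (dim I)"
proof -
  have "\<not> A \<subseteq> S" using S(3) I_psubset_A by blast
  hence proper: "S \<noteq> UNIV" by blast
  have "maximal_subalgebra S" unfolding maximal_subalgebra_def
  proof (intro conjI allI impI S(1) proper notI)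
    fix M assume M: "subalgebra M \<and> M \<noteq> UNIV" "S \<subset> M"
    hence sM: "subspace M" by (simp add: subalgebra_def)
    have "M \<inter> A = I \<or> M \<inter> A = A"
    proof (rule left_stable_cases)
      show "subspace (M \<inter> A)" using sM subspace_A by (rule subspace_inter)
      show "I \<subseteq> M \<inter> A" "M \<inter> A \<subseteq> A" using S(2) M(2) I_psubset_A by auto
      fix y w assume w: "w \<in> M \<inter> A"
      obtain a where a: "a \<in> A" "y - a \<in> S" using S(4) by blast
      \<comment> \<open>The part of \<open>y\<close> in \<open>S\<close> preserves \<open>M\<close>,
        and the part in \<open>A\<close> sends \<open>w\<close> into \<open>I\<close> because
        \<open>A / I\<close> is abelian.\<close>
      have "(y - a) \<cdot> w + a \<cdot> w \<in> M"
      proof (rule subspace_add[OF sM])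
        show "(y - a) \<cdot> w \<in> M" using M a w by (auto simp: subalgebra_def)
        show "a \<cdot> w \<in> M" using abel[of a w] a w S(2) M(2) by blast
      qed
      thus "y \<cdot> w \<in> M \<inter> A" using w ideal_right[OF ideal_A] by (simp add: mult_linear_simps)
    qed
    thus False
    proof
      assume MA: "M \<inter> A = I"
      have "M \<subseteq> S"
      proof
        fix y assume y: "y \<in> M"
        obtain a where a: "a \<in> A" "y - a \<in> S" using S(4) by blast
        have "y - (y - a) \<in> M" using subspace_diff[OF sM y] a M(2) by blast
        hence "a \<in> S" using MA a S(2) by auto
        thus "y \<in> S" using subspace_add[OF subalgebra_subspace[OF S(1)] a(2)] by force
      qed
      thus False using M by blast
    next
      assume MA: "M \<inter> A = A"
      have "y \<in> M" for y
      proof -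
        obtain a where a: "a \<in> A" "y - a \<in> S" using S(4) by blast
        hence "(y - a) + a \<in> M" using subspace_add[OF sM] M(2) MA by blast
        thus ?thesis by simp
      qed
      thus False using M by blast
    qed
  qed
  hence "quotient_dim UNIV S 1" by (rule codim)
  hence d: "dim (UNIV :: 'b set) = Suc (dim S)"
    using quotient_dim_1_iff[of S UNIV] subalgebra_subspace[OF S(1)] by simp
  have "{x + y |x y. x \<in> S \<and> y \<in> A} = UNIV"
  proof (intro equalityI subsetI UNIV_I)
    fix y :: 'b
    obtain a where "a \<in> A" "y - a \<in> S" using S(4) by blast
    thus "y \<in> {x + y |x y. x \<in> S \<and> y \<in> A}" by (intro CollectI exI[of _ "y - a"] exI[of _ a]) simp
  qed
  moreover have "S \<inter> A = I" using S I_psubset_A by blast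
  ultimately show ?thesis
    using dim_sums_Int[OF subalgebra_subspace[OF S(1)] subspace_A] d by simp
qed

text \<open>For \<open>x\<close> acting bijectively on \<open>A / I\<close> and nilpotently on the algebra modulo \<open>A\<close>, the Fitting
  null component of \<open>x\<close> is a complement of \<open>A\<close> modulo \<open>I\<close>.\<close>
lemma dim_1_of_bijective_action:
  assumes abel: "\<And>a b. a \<in> A \<Longrightarrow> b \<in> A \<Longrightarrow> a \<cdot> b \<in> I"
    and codim: "\<And>M. maximal_subalgebra M \<Longrightarrow> quotient_dim UNIV M 1"
    and inj: "\<And>a. a \<in> A \<Longrightarrow> x \<cdot> a \<in> I \<Longrightarrow> a \<in> I"
    and surj: "\<And>a. a \<in> A \<Longrightarrow> \<exists>b\<in>A. a - x \<cdot> b \<in> I"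
    and nil: "\<And>y. (mult x ^^ n) y \<in> A"
  shows "dim A = Suc (dim I)"
proof (rule dim_1_of_complement[OF abel codim])
  show "subalgebra (fitting_null I x)" by (rule subalgebra_fitting_null[OF ideal_I])
  show "I \<subseteq> fitting_null I x" by (auto intro: fitting_null_base)
  \<comment> \<open>Powers of an injective action on \<open>A / I\<close> are injective.\<close>
  have "a \<in> I" if "(mult x ^^ m) a \<in> I" "a \<in> A" for m a
    using that
  proof (induction m arbitrary: a)
    case (Suc m)
    hence "x \<cdot> a \<in> I" using ideal_right[OF ideal_A] by (simp add: funpow_swap1)
    thus ?case using inj Suc by blast
  qed simp
  thus "fitting_null I x \<inter> A \<subseteq> I" by (auto simp: fitting_null_def)
  \<comment> \<open>If \<open>x \<cdot> y\<close> has been corrected by \<open>a\<close>, a preimage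
    \<open>b\<close> of \<open>a\<close> under \<open>x\<close> modulo \<open>I\<close> corrects
    \<open>y\<close>.\<close>
  have "(mult x ^^ m) y \<in> A \<Longrightarrow> \<exists>a\<in>A. y - a \<in> fitting_null I x" for m y
  proof (induction m arbitrary: y)
    case 0
    thus ?case using fitting_null_base[OF subspace_0[OF subspace_I]] by (intro bexI[of _ y]) auto
  next
    case (Suc m)
    hence "(mult x ^^ m) (x \<cdot> y) \<in> A" by (simp add: funpow_swap1)
    then obtain a where a: "a \<in> A" "x \<cdot> y - a \<in> fitting_null I x" using Suc.IH by blast
    obtain b where b: "b \<in> A" "a - x \<cdot> b \<in> I" using surj a by blast
    have "(x \<cdot> y - a) + (a - x \<cdot> b) \<in> fitting_null I x"
      by (rule subspace_add[OF subalgebra_subspace[OF subalgebra_fitting_null[OF ideal_I]]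
            a(2) fitting_null_base[OF b(2)]])
    hence "x \<cdot> (y - b) \<in> fitting_null I x" by (simp add: mult_linear_simps)
    thus ?case using b by (blast intro: fitting_null_step)
  qed
  thus "\<exists>a\<in>A. y - a \<in> fitting_null I x" for y using nil by blast
qed

text \<open>Schur's lemma: the operators \<open>x \<cdot> _\<close> commute on \<open>A / I\<close>, so an eigenspace of one of them is stable
  under all of them and hence everything.\<close>
lemma dim_1_of_derived_trivial:
  assumes root: "\<And>p::'a poly. degree p > 0 \<Longrightarrow> \<exists>z. poly p z = 0"
    and triv: "\<And>x y a. a \<in> A \<Longrightarrow> (x \<cdot> y) \<cdot> a \<in> I"
  shows "dim A = Suc (dim I)"
proof -
  obtain a where a: "a \<in> A" "a \<notin> I" using I_psubset_A by blast
  have scal: "\<exists>c. \<forall>b\<in>A. y \<cdot> b - c *s b \<in> I" for y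
  proof -
    obtain b c where b: "b \<in> A" "b \<notin> I" "y \<cdot> b - c *s b \<in> I"
      using eigenvector_modulo_subspace[OF root linear_mult_right subspace_I subspace_A _ a]
        ideal_right[OF ideal_A] by metis
    define E where "E = {b \<in> A. y \<cdot> b - c *s b \<in> I}"
    have "E = I \<or> E = A"
    proof (rule left_stable_cases)
      have lin: "y \<cdot> (u + v) - c *s (u + v) = (y \<cdot> u - c *s u) + (y \<cdot> v - c *s v)"
        "y \<cdot> (d *s u) - c *s (d *s u) = d *s (y \<cdot> u - c *s u)" for u v d
        by (simp_all add: mult_linear_simps scale_right_distrib scale_right_diff_distrib
            scale_left_commute[of c])
      show "subspace E"
      proof (rule subspaceI)
        show "0 \<in> E" by (simp add: E_def mult_zero_right subspace_0 subspace_I subspace_A)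
        fix u v d assume "u \<in> E"
        thus "d *s u \<in> E" unfolding E_def mem_Collect_eq lin
          by (blast intro: subspace_scale[OF subspace_I] subspace_scale[OF subspace_A])
        assume "v \<in> E"
        with \<open>u \<in> E\<close> show "u + v \<in> E" unfolding E_def mem_Collect_eq lin
          by (blast intro: subspace_add[OF subspace_I] subspace_add[OF subspace_A])
      qed
      show "I \<subseteq> E" using I_psubset_A ideal_right[OF ideal_I]
        by (auto simp: E_def intro!: subspace_diff[OF subspace_I] subspace_scale[OF subspace_I])
      show "E \<subseteq> A" by (auto simp: E_def)
      fix z w assume w: "w \<in> E"
      \<comment> \<open>The commutator of \<open>y\<close> and \<open>z\<close> acts as
        \<open>y \<cdot> z\<close>, hence as zero on \<open>A / I\<close>, so \<open>z\<close>
        preserves the eigenspace \<open>E\<close> of \<open>y\<close>.\<close>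
      have "y \<cdot> (z \<cdot> w) - c *s (z \<cdot> w) = (y \<cdot> z) \<cdot> w + z \<cdot> (y \<cdot> w - c *s w)"
        by (simp add: leibniz[of y] mult_linear_simps)
      also have "\<dots> \<in> I" using w triv ideal_right[OF ideal_I]
        by (intro subspace_add[OF subspace_I]) (auto simp: E_def)
      finally show "z \<cdot> w \<in> E" using w ideal_right[OF ideal_A] by (auto simp: E_def)
    qed
    hence "E = A" using b by (auto simp: E_def)
    thus ?thesis by (auto simp: E_def)
  qed
  \<comment> \<open>All left actions on \<open>A / I\<close> are scalar, so every subspace between
    \<open>I\<close> and \<open>A\<close> is left stable, in particular the one generated by a
    single extra vector.\<close>
  have "span (insert a I) = I \<or> span (insert a I) = A"
  proof (rule left_stable_cases)
    show "I \<subseteq> span (insert a I)" by (auto intro: span_base)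
    show sA: "span (insert a I) \<subseteq> A" using a I_psubset_A subspace_A by (intro span_minimal) auto
    fix y w assume w: "w \<in> span (insert a I)"
    obtain c where "\<forall>b\<in>A. y \<cdot> b - c *s b \<in> I" using scal by blast
    hence "y \<cdot> w - c *s w \<in> span (insert a I)" using w sA by (auto intro: span_base)
    thus "y \<cdot> w \<in> span (insert a I)" using span_add[OF _ span_scale[OF w, of c]] by force
  qed simp
  hence "span (insert a I) = A" using a span_base[of a "insert a I"] by auto
  hence "dim A = dim (insert a I)" by (metis dim_span)
  thus ?thesis using a subspace_I by (simp add: dim_insert span_eq_iff[THEN iffD2])
qed

text \<open>Under the contrary assumption no element can act bijectively on \<open>A / I\<close> and
  nilpotently modulo \<open>A\<close>. By induction on \<open>j\<close>, the elements of
  \<open>N\<close> in \<open>L j\<close> then act as zero on \<open>A / I\<close>. At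
  \<open>j = k\<close> this covers all products.\<close>

lemma dim_1:
  assumes root: "\<And>p::'a poly. degree p > 0 \<Longrightarrow> \<exists>z. poly p z = 0"
    and solv: "solvable"
    and codim: "\<And>M. maximal_subalgebra M \<Longrightarrow> quotient_dim UNIV M 1"
    and above: "supersolvable_above A"
  shows "dim A = Suc (dim I)"
proof (rule ccontr)
  assume contra: "dim A \<noteq> Suc (dim I)"
  note abel = abelian_of_solvable[OF solv]
  obtain k L where L: "L 0 = A" "L k = UNIV" "\<forall>j\<le>k. ideal (L j)"
    "\<forall>j<k. L j \<subseteq> L (Suc j) \<and> dim (L (Suc j)) = Suc (dim (L j))"
    using above unfolding supersolvable_above_alt by blast
  have sL: "subspace (L j)" if "j \<le> k" for j using L(3) that ideal_subspace by blast
  \<comment> \<open>The elements acting as zero on every one-dimensional factor of the chain from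
    \<open>A\<close> to the whole algebra.\<close>
  define N where "N = {x. \<forall>j<k. \<forall>w\<in>L (Suc j). x \<cdot> w \<in> L j}"
  have sN: "subspace N"
    by (rule subspaceI)
      (auto simp: N_def mult_linear_simps subspace_0 subspace_add subspace_scale sL)
  have prodN: "x \<cdot> y \<in> N" for x y
    unfolding N_def
  proof (intro CollectI allI impI ballI)
    fix j w assume j: "j < k" and w: "w \<in> L (Suc j)"
    have id: "ideal (L j)" "ideal (L (Suc j))" using L(3) j by auto
    note sub = ideal_subspace[OF id(1)] ideal_subspace[OF id(2)]
    have sb: "L j \<subseteq> L (Suc j)" "dim (L (Suc j)) = Suc (dim (L j))" using L j by auto
    show "(x \<cdot> y) \<cdot> w \<in> L j"
    proof (cases "w \<in> L j")
      case True thus ?thesis using ideal_right[OF id(1)] by blast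
    next
      case False
      note decomp = dim_Suc_decomp[OF sub sb w False]
      obtain c where c: "x \<cdot> w - c *s w \<in> L j" using decomp ideal_right[OF id(2) w] by metis
      obtain d where d: "y \<cdot> w - d *s w \<in> L j" using decomp ideal_right[OF id(2) w] by metis
      \<comment> \<open>With \<open>x\<close> and \<open>y\<close> acting on the factor as the
        scalars \<open>c\<close> and \<open>d\<close>, the contributions
        \<open>c *s (d *s w)\<close> of the two orders cancel.\<close>
      have "(x \<cdot> y) \<cdot> w = x \<cdot> (y \<cdot> w - d *s w) - y \<cdot> (x \<cdot> w - c *s w)
          + (d *s (x \<cdot> w - c *s w) - c *s (y \<cdot> w - d *s w))"
        by (simp add: mult_mult_left mult_linear_simps scale_right_diff_distrib
            scale_left_commute[of c])
      also have "\<dots> \<in> L j"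
        by (intro subspace_add[OF sub(1)] subspace_diff[OF sub(1) ideal_right[OF id(1) d]]
            subspace_diff[OF sub(1) subspace_scale[OF sub(1) c]]
            ideal_right[OF id(1) c] subspace_scale[OF sub(1) d])
      finally show ?thesis .
    qed
  qed
  have nil: "(mult x ^^ k) y \<in> A" if "x \<in> N" for x y
  proof -
    have "i \<le> k \<Longrightarrow> (mult x ^^ i) y \<in> L (k - i)" for i
    proof (induction i)
      case (Suc i)
      hence "(mult x ^^ i) y \<in> L (Suc (k - Suc i))" "k - Suc i < k" by (auto simp: Suc_diff_Suc)
      thus ?case using that by (simp add: N_def)
    qed (use L in auto)
    from this[of k] show ?thesis using L by simp
  qed
  have "j \<le> k \<Longrightarrow> x \<in> N \<Longrightarrow> x \<in> L j \<Longrightarrow> a \<in> A \<Longrightarrow> x \<cdot> a \<in> I" for j x a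
  proof (induction j arbitrary: x a)
    case 0
    thus ?case using abel L by simp
  next
    case (Suc j)
    have id: "ideal (L j)" "ideal (L (Suc j))" using L(3) Suc.prems by auto
    note sub = ideal_subspace[OF id(1)] ideal_subspace[OF id(2)]
    have sb: "L j \<subseteq> L (Suc j)" "dim (L (Suc j)) = Suc (dim (L j))" using L Suc.prems by auto
    show ?case
    proof (cases "x \<in> L j")
      case True thus ?thesis using Suc by simp
    next
      case False
      \<comment> \<open>Modulo \<open>L j\<close>, \<open>u\<close> is a multiple of
        \<open>x\<close>. The difference stays in \<open>N\<close>, so by induction it acts as zero
        on \<open>A / I\<close>.\<close>
      have comm: "\<exists>c. \<forall>b\<in>A. u \<cdot> b - c *s (x \<cdot> b) \<in> I" if u: "u \<in> N" "u \<in> L (Suc j)" for u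
      proof -
        obtain c where c: "u - c *s x \<in> L j"
          using dim_Suc_decomp[OF sub sb Suc.prems(3) False u(2)] by blast
        have "u - c *s x \<in> N" using u Suc.prems sN by (intro subspace_diff subspace_scale)
        hence "\<forall>b\<in>A. (u - c *s x) \<cdot> b \<in> I" using Suc.IH c Suc.prems(1) by auto
        thus ?thesis by (auto simp: mult_linear_simps)
      qed
      \<comment> \<open>\<open>U\<close> and \<open>V\<close> are the kernel and the image of
        \<open>x\<close> on \<open>A / I\<close>.\<close>
      define U where "U = {a \<in> A. x \<cdot> a \<in> I}"
      define V where "V = {a \<in> A. \<exists>b\<in>A. a - x \<cdot> b \<in> I}"
      have U: "U = I \<or> U = A"
      proof (rule left_stable_cases)
        show "subspace U" unfolding U_def
          using subspace_inter[OF subspace_A subspace_preimage_right[OF subspace_I, of x]]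
          by (simp add: Int_def)
        show "I \<subseteq> U" "U \<subseteq> A" using I_psubset_A ideal_right[OF ideal_I] by (auto simp: U_def)
        fix y w assume w: "w \<in> U"
        obtain c where "\<forall>b\<in>A. (x \<cdot> y) \<cdot> b - c *s (x \<cdot> b) \<in> I"
          using comm[OF prodN ideal_left[OF id(2) Suc.prems(3)]] by blast
        \<comment> \<open>By the Leibniz rule this sum is \<open>x \<cdot> (y \<cdot> w)\<close>;
          the product \<open>x \<cdot> y\<close> acts as a multiple of \<open>x\<close> by
          \<open>comm\<close>.\<close>
        hence "(x \<cdot> y) \<cdot> w - c *s (x \<cdot> w) + c *s (x \<cdot> w) + y \<cdot> (x \<cdot> w) \<in> I"
          using w ideal_right[OF ideal_I]
          by (intro subspace_add[OF subspace_I] subspace_scale[OF subspace_I]) (auto simp: U_def)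
        thus "y \<cdot> w \<in> U" using w ideal_right[OF ideal_A] by (simp add: U_def leibniz[of x])
      qed
      have V: "V = I \<or> V = A"
      proof (rule left_stable_cases)
        show "subspace V"
        proof (rule subspaceI)
          show "0 \<in> V" unfolding V_def using subspace_0[OF subspace_I] subspace_0[OF subspace_A]
            by (auto intro!: bexI[of _ 0] simp: mult_zero_right)
          fix u v c assume "u \<in> V"
          then obtain b where b: "u \<in> A" "b \<in> A" "u - x \<cdot> b \<in> I" by (auto simp: V_def)
          have "c *s u - x \<cdot> (c *s b) \<in> I" using subspace_scale[OF subspace_I b(3), of c]
            by (simp add: mult_linear_simps scale_right_diff_distrib)
          thus "c *s u \<in> V" using b subspace_scale[OF subspace_A] by (auto simp: V_def)
          assume "v \<in> V"
          then obtain b' where b': "v \<in> A" "b' \<in> A" "v - x \<cdot> b' \<in> I" by (auto simp: V_def)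
          have "(u + v) - x \<cdot> (b + b') \<in> I" using subspace_add[OF subspace_I b(3) b'(3)]
            by (simp add: mult_linear_simps algebra_simps)
          thus "u + v \<in> V" using b b' subspace_add[OF subspace_A] by (auto simp: V_def)
        qed
        show "I \<subseteq> V" unfolding V_def using I_psubset_A subspace_0[OF subspace_A]
          by (auto intro!: bexI[of _ 0] simp: mult_zero_right)
        show "V \<subseteq> A" by (auto simp: V_def)
        fix y w assume "w \<in> V"
        then obtain b where b: "w \<in> A" "b \<in> A" "w - x \<cdot> b \<in> I" by (auto simp: V_def)
        obtain c where c: "\<forall>b\<in>A. (y \<cdot> x) \<cdot> b - c *s (x \<cdot> b) \<in> I"
          using comm[OF prodN ideal_right[OF id(2) Suc.prems(3)]] by blast
        \<comment> \<open>Modulo \<open>I\<close>, \<open>y \<cdot> w\<close> is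
          \<open>y \<cdot> (x \<cdot> b)\<close>, that is
          \<open>(y \<cdot> x) \<cdot> b + x \<cdot> (y \<cdot> b)\<close>, and
          \<open>y \<cdot> x\<close> acts as \<open>c\<close> times \<open>x\<close>; so the witness
          is \<open>y \<cdot> b + c *s b\<close>.\<close>
        have "y \<cdot> (w - x \<cdot> b) + ((y \<cdot> x) \<cdot> b - c *s (x \<cdot> b)) \<in> I"
          using b c ideal_right[OF ideal_I] by (intro subspace_add[OF subspace_I]) auto
        hence "y \<cdot> w - x \<cdot> (y \<cdot> b + c *s b) \<in> I"
          by (simp add: mult_linear_simps leibniz[of y] algebra_simps)
        moreover have "y \<cdot> b + c *s b \<in> A" "y \<cdot> w \<in> A"
          using b ideal_right[OF ideal_A] subspace_add[OF subspace_A] subspace_scale[OF subspace_A]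
          by auto
        ultimately show "y \<cdot> w \<in> V" by (auto simp: V_def)
      qed
      have "U = A"
      proof (rule ccontr)
        assume UA: "U \<noteq> A"
        hence UI: "U = I" using U by blast
        \<comment> \<open>A zero image would make the kernel all of \<open>A\<close>.\<close>
        have "V \<noteq> I"
        proof
          assume VI: "V = I"
          have "x \<cdot> b \<in> V" if "b \<in> A" for b
            using that ideal_right[OF ideal_A] subspace_0[OF subspace_I]
            by (auto simp: V_def intro!: bexI[of _ b])
          hence "A \<subseteq> U" using VI by (auto simp: U_def)
          thus False using UA by (auto simp: U_def)
        qed
        hence VA: "V = A" using V by blast
        have "dim A = Suc (dim I)"
        proof (rule dim_1_of_bijective_action[OF abel codim])
          show "\<And>a. a \<in> A \<Longrightarrow> x \<cdot> a \<in> I \<Longrightarrow> a \<in> I" using UI by (auto simp: U_def)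
          show "\<And>a. a \<in> A \<Longrightarrow> \<exists>b\<in>A. a - x \<cdot> b \<in> I" using VA by (auto simp: V_def)
          show "\<And>y. (mult x ^^ k) y \<in> A" using nil Suc.prems by blast
        qed
        thus False using contra by blast
      qed
      thus ?thesis using Suc.prems by (auto simp: U_def)
    qed
  qed
  from this[of k] have "x \<cdot> a \<in> I" if "x \<in> N" "a \<in> A" for x a using that L by auto
  hence "dim A = Suc (dim I)" using prodN by (intro dim_1_of_derived_trivial[OF root]) auto
  thus False using contra by blast
qed

end

section \<open>Assembling the chain of ideals\<close>

context finite_dimensional_left_leibniz_algebra
begin

text \<open>Induction on the codimension of \<open>I\<close>. An ideal \<open>A\<close> of least
  dimension among those strictly above \<open>I\<close> gives a chief factor \<open>A / I\<close>;
  the induction hypothesis supplies the chain above \<open>A\<close>, and \<open>dim_1\<close>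
  allows \<open>I\<close> to be put below it.\<close>

lemma supersolvable_above_ideal:
  assumes root: "\<And>p::'a poly. degree p > 0 \<Longrightarrow> \<exists>z. poly p z = 0"
    and solv: "solvable"
    and codim: "\<And>M. maximal_subalgebra M \<Longrightarrow> quotient_dim UNIV M 1"
    and "ideal I"
  shows "supersolvable_above I"
  using \<open>ideal I\<close>
proof (induction "dimension - dim I" arbitrary: I rule: less_induct)
  case less
  show ?case
  proof (cases "I = UNIV")
    case True thus ?thesis using supersolvable_above_UNIV by simp
  next
    case False
    define P where "P J \<longleftrightarrow> ideal J \<and> I \<subset> J" for J
    have "P UNIV" using False by (auto simp: P_def ideal_def)
    then obtain A where A: "P A" "\<And>J. P J \<Longrightarrow> dim A \<le> dim J"
      using ex_has_least_nat[of P UNIV dim] by blast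
    interpret leibniz_chief_factor scale mult Basis I A
    proof
      show "ideal I" "ideal A" "I \<subset> A" using less A by (auto simp: P_def)
      fix J assume J: "ideal J" "I \<subseteq> J" "J \<subseteq> A"
      show "J = I \<or> J = A"
      proof (rule ccontr)
        assume "\<not> (J = I \<or> J = A)"
        hence "P J" "J \<subset> A" using J by (auto simp: P_def)
        thus False using A dim_less_of_psubset[of J A] J(1) ideal_subspace
          by (fastforce simp: P_def)
      qed
    qed
    have "dim I < dim A" by (rule dim_less_of_psubset[OF subspace_I subspace_A I_psubset_A])
    moreover have "dim A \<le> dimension" by (rule dim_subset_UNIV)
    ultimately have "supersolvable_above A" using less.hyps ideal_A by simp
    thus ?thesis
      using dim_1[OF root solv codim] supersolvable_above_step[OF ideal_I] I_psubset_A by blast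
  qed
qed

end

theorem corollary5p2:
  fixes scale :: "'k::alg_closed_field \<Rightarrow> 'v::ab_group_add \<Rightarrow> 'v"
    and mult :: "'v \<Rightarrow> 'v \<Rightarrow> 'v"
    and Basis :: "'v set"
  assumes "finite_dimensional_left_leibniz_algebra scale mult Basis"
  shows "left_leibniz_algebra.supersolvable scale mult \<longleftrightarrow>
    left_leibniz_algebra.solvable scale mult \<and>
    (\<forall>M. left_leibniz_algebra.maximal_subalgebra scale mult M \<longrightarrow>
      vector_space.quotient_dim scale UNIV M 1)"
proof -
  interpret finite_dimensional_left_leibniz_algebra scale mult Basis by fact
  \<comment> \<open>The chain is started at the zero ideal; \<open>root\<close> is supplied by the
    class \<open>alg_closed_field\<close>.\<close>
  have "ideal {0}" by (simp add: ideal_def mult_zero_right mult_zero_left)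
  hence "supersolvable" if "solvable" "\<forall>M. maximal_subalgebra M \<longrightarrow> quotient_dim UNIV M 1"
    unfolding supersolvable_iff
    using that supersolvable_above_ideal[OF alg_closed_imp_poly_has_root] by blast
  thus ?thesis
    using solvable_of_supersolvable maximal_subalgebra_codim_1_of_supersolvable by blast
qed

end
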